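(* Let $E$ be a complex Banach space with topological antidual $\bar{E}'$, and let $A,B\in\mathscr{B}(E;\bar{E}')$ be bounded positive operators. With the Hilbert spaces $H_A,H_B$, the operators $\widetilde J_A,\widetilde J_B:H_A\times H_B\to\bar E'$, the map $j_E$ and the projection $P$ defined in the context, the positive operators $\widetilde{J}_AP\widetilde{J}_A^*\circ j_E$ and $\widetilde{J}_BP\widetilde{J}_B^*\circ j_E$ from $E$ to $\bar E'$ are equal, and for every $x\in E$ $$\big\langle(\widetilde{J}_AP\widetilde{J}_A^*\circ j_E)(x),x\big\rangle=\inf\{\langle A(x-y),x-y\rangle+\langle By,y\rangle:y\in E\}.$$
   Context: Inner products are linear in the first variable. $\bar{E}'$ is the Banach space of all continuous conjugate-linear functionals $f:E\to\mathbb C$, with the functional norm; $\langle f,x\rangle:=f(x)$. $\mathscr{B}(E;\bar E')$ is the space of bounded linear operators from $E$ to $\bar E'$; $A\in\mathscr{B}(E;\bar E')$ is positive if $\langle Ax,x\rangle\ge0$ for all $x\in E$. For positive $A$, $\operatorname{ran}A$ is equipped with the inner product $(Ax\mid Ay)_A:=\langle Ax,y\rangle$, $x,y\in E$, and $H_A$ is its Hilbert space completion; $H_B$ is defined analogously from $B$. $\bar E''$ denotes the antidual of $\bar E'$, and $j_E:E\to\bar E''$ is the linear isometry $j_E(x)=\widehat x$, $\widehat x(f):=\overline{f(x)}$, $f\in\bar E'$. The bounded operators $J,\widetilde J_A,\widetilde J_B:H_A\times H_B\to\bar E'$ are the continuous extensions of $$J(Ax,By):=Ax+By,\qquad \widetilde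 J_A(Ax,By):=Ax,\qquad \widetilde J_B(Ax,By):=By,\qquad x,y\in E.$$ For a bounded linear operator $S$ from a Hilbert space $K$ to $\bar E'$, the adjoint $S^*:\bar E''\to K$ is defined by $(S^*\varphi\mid\xi)_K=\varphi(S\xi)$ for $\varphi\in\bar E''$, $\xi\in K$. One has $(J^*\circ j_E)(x)=(Ax,Bx)$, $(\widetilde J_A^*\circ j_E)(x)=(Ax,0)$, $(\widetilde J_B^*\circ j_E)(x)=(0,Bx)$ for $x\in E$. $P$ is the orthogonal projection of $H_A\times H_B$ onto $\{\operatorname{ran}(J^*\circ j_E)\}^{\perp}$. *)

theory Defs
  imports "HOL-Analysis.Analysis"
begin

class complex_normed_vector = real_normed_vector +
  fixes scaleC :: "complex \<Rightarrow> 'a \<Rightarrow> 'a" (infixr "*\<^sub>C" 75)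
  assumes scaleC_add_right: "c *\<^sub>C (x + y) = c *\<^sub>C x + c *\<^sub>C y"
    and scaleC_add_left: "(c + d) *\<^sub>C x = c *\<^sub>C x + d *\<^sub>C x"
    and scaleC_scaleC: "c *\<^sub>C d *\<^sub>C x = (c * d) *\<^sub>C x"
    and scaleC_of_real: "complex_of_real r *\<^sub>C x = r *\<^sub>R x"
    and norm_scaleC: "norm (c *\<^sub>C x) = cmod c * norm x"

class complex_banach = complex_normed_vector + complete_space

(* The axiom cinner_self contains positive definiteness. *)
class complex_inner = complex_normed_vector +
  fixes cinner :: "'a \<Rightarrow> 'a \<Rightarrow> complex"
  assumes cinner_add_left: "cinner (x + y) z = cinner x z + cinner y z"
    and cinner_scaleC_left: "cinner (c *\<^sub>C x) y = c * cinner x y"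
    and cinner_commute: "cinner x y = cnj (cinner y x)"
    and cinner_self: "cinner x x = complex_of_real ((norm x)\<^sup>2)"

class complex_hilbert = complex_inner + complete_space

instantiation prod :: (complex_normed_vector, complex_normed_vector) complex_normed_vector
begin

definition "c *\<^sub>C z = (c *\<^sub>C fst z, c *\<^sub>C snd z)"

instance
proof
  fix c :: complex and z :: "'a \<times> 'b"
  show "norm (c *\<^sub>C z) = cmod c * norm z"
    by (simp add: scaleC_prod_def norm_prod_def norm_scaleC power_mult_distrib
        distrib_left [symmetric] real_sqrt_mult)
qed (simp_all add: scaleC_prod_def scaleC_add_right scaleC_add_left scaleC_scaleC
    scaleC_of_real prod_eq_iff)

end

instantiation prod :: (complex_inner, complex_inner) complex_inner
begin

definition "cinner z w = cinner (fst z) (fst w) + cinner (snd z) (snd w)"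

instance
proof
  fix z w :: "'a \<times> 'b"
  show "cinner z w = cnj (cinner w z)"
    using cinner_commute [of "fst z" "fst w"] cinner_commute [of "snd z" "snd w"]
    by (simp add: cinner_prod_def)
  show "cinner z z = complex_of_real ((norm z)\<^sup>2)"
    by (simp add: cinner_prod_def cinner_self norm_prod_def)
qed (simp_all add: cinner_prod_def scaleC_prod_def cinner_add_left cinner_scaleC_left
    algebra_simps)

end

instance prod :: (complex_hilbert, complex_hilbert) complex_hilbert ..

definition bounded_clinear ::
  "('a::complex_normed_vector \<Rightarrow> 'b::complex_normed_vector) \<Rightarrow> bool" where
  "bounded_clinear T \<longleftrightarrow> bounded_linear T \<and> (\<forall>c x. T (c *\<^sub>C x) = c *\<^sub>C T x)"

typedef (overloaded) ('a::complex_normed_vector) antidual =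
  "{f :: 'a \<Rightarrow> complex. bounded_linear f \<and> (\<forall>c x. f (c *\<^sub>C x) = cnj c * f x)}"
  morphisms antidual_apply Antidual
  by (rule exI [of _ "\<lambda>_. 0"]) simp

setup_lifting type_definition_antidual

lemma antidual_bounded_linear: "bounded_linear (antidual_apply f)"
  using antidual_apply [of f] by simp

lemma antidual_apply_scaleC: "antidual_apply f (c *\<^sub>C x) = cnj c * antidual_apply f x"
  using antidual_apply [of f] by simp

lemma antidual_eqI: "(\<And>x. antidual_apply f x = antidual_apply g x) \<Longrightarrow> f = g"
  by (simp add: antidual_apply_inject [symmetric] fun_eq_iff)

instantiation antidual :: (complex_normed_vector) complex_normed_vector
begin

lift_definition zero_antidual :: "'a antidual" is "\<lambda>_. 0"
  by simp

lift_definition plus_antidual :: "'a antidual \<Rightarrow> 'a antidual \<Rightarrow> 'a antidual"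
  is "\<lambda>f g x. f x + g x"
  by (simp add: bounded_linear_add distrib_left)

lift_definition minus_antidual :: "'a antidual \<Rightarrow> 'a antidual \<Rightarrow> 'a antidual"
  is "\<lambda>f g x. f x - g x"
  by (simp add: bounded_linear_sub right_diff_distrib)

lift_definition uminus_antidual :: "'a antidual \<Rightarrow> 'a antidual"
  is "\<lambda>f x. - f x"
  by (simp add: bounded_linear_minus)

lift_definition scaleR_antidual :: "real \<Rightarrow> 'a antidual \<Rightarrow> 'a antidual"
  is "\<lambda>r f x. r *\<^sub>R f x"
  by (simp add: bounded_linear_const_scaleR)

lift_definition scaleC_antidual :: "complex \<Rightarrow> 'a antidual \<Rightarrow> 'a antidual"
  is "\<lambda>c f x. c * f x"
  by (simp add: bounded_linear_const_mult)

lift_definition norm_antidual :: "'a antidual \<Rightarrow> real" is onorm .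

definition "dist (f::'a antidual) g = norm (f - g)"
definition "sgn (f::'a antidual) = inverse (norm f) *\<^sub>R f"
definition [code del]:
  "(uniformity :: ('a antidual \<times> 'a antidual) filter) =
     (INF e\<in>{0<..}. principal {(f, g). dist f g < e})"
definition [code del]:
  "open (S :: 'a antidual set) \<longleftrightarrow>
     (\<forall>f\<in>S. \<forall>\<^sub>F (f', g) in uniformity. f' = f \<longrightarrow> g \<in> S)"

instance
proof
  fix f g :: "'a antidual" and r :: real and c :: complex
  show "norm f = 0 \<longleftrightarrow> f = 0"
    by transfer (auto simp: onorm_eq_0 fun_eq_iff)
  show "norm (f + g) \<le> norm f + norm g"
    by transfer (simp add: onorm_triangle)
  show "norm (r *\<^sub>R f) = \<bar>r\<bar> * norm f"
    by transfer (simp add: onorm_scaleR)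
  show "complex_of_real r *\<^sub>C f = r *\<^sub>R f"
    by transfer (simp add: scaleR_conv_of_real)
  have *: "onorm (\<lambda>x. d * h x) \<le> cmod d * onorm h"
    if h: "bounded_linear h" for d :: complex and h :: "'a \<Rightarrow> complex"
    by (rule onorm_bound)
      (auto simp: norm_mult mult.assoc onorm_pos_le [OF h] intro!: mult_left_mono onorm [OF h])
  show "norm (c *\<^sub>C f) = cmod c * norm f"
  proof transfer
    fix c :: complex and f :: "'a \<Rightarrow> complex"
    assume "bounded_linear f \<and> (\<forall>c x. f (c *\<^sub>C x) = cnj c * f x)"
    then have f: "bounded_linear f" ..
    show "onorm (\<lambda>x. c * f x) = cmod c * onorm f"
    proof (cases "c = 0")
      case True
      then show ?thesis by (simp add: onorm_zero)
    next
      case False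
      have "onorm (\<lambda>x. inverse c * (c * f x)) \<le> cmod (inverse c) * onorm (\<lambda>x. c * f x)"
        by (rule *) (simp add: f bounded_linear_const_mult)
      with False have "cmod c * onorm f \<le> onorm (\<lambda>x. c * f x)"
        by (simp add: mult.assoc [symmetric] norm_inverse norm_divide field_simps)
      with * [OF f, of c] show ?thesis by simp
    qed
  qed
qed (simp_all add: dist_antidual_def sgn_antidual_def uniformity_antidual_def
    open_antidual_def, (transfer, simp add: algebra_simps)+)

end

definition positive_operator :: "('e::complex_normed_vector \<Rightarrow> 'e antidual) \<Rightarrow> bool" where
  "positive_operator A \<longleftrightarrow>
     bounded_clinear A \<and> (\<forall>x. antidual_apply (A x) x \<in> \<real>\<^sub>\<ge>\<^sub>0)"

(* The Hilbert space type 'h together with the map i (only its values on range A matter)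
   is a completion of range A with respect to the inner product (A x | A y) = (A x)(y). *)
definition hilbert_completion ::
  "('e::complex_normed_vector \<Rightarrow> 'e antidual) \<Rightarrow> ('e antidual \<Rightarrow> 'h::complex_hilbert) \<Rightarrow> bool"
  where
  "hilbert_completion A i \<longleftrightarrow>
     (\<forall>f\<in>range A. \<forall>g\<in>range A. i (f + g) = i f + i g) \<and>
     (\<forall>c. \<forall>f\<in>range A. i (c *\<^sub>C f) = c *\<^sub>C i f) \<and>
     (\<forall>x y. cinner (i (A x)) (i (A y)) = antidual_apply (A x) y) \<and>
     closure (i ` range A) = UNIV"

lift_definition canonical_embedding ::
  "'e::complex_normed_vector \<Rightarrow> 'e antidual antidual"
  is "\<lambda>x f. cnj (antidual_apply f x)"
proof (intro conjI allI)
  fix x :: 'e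
  have le: "cmod (antidual_apply f x) \<le> norm f * norm x" for f :: "'e antidual"
    using onorm [OF antidual_bounded_linear [of f], of x] by (simp add: norm_antidual.rep_eq)
  show "bounded_linear (\<lambda>f. cnj (antidual_apply f x))"
    by (rule bounded_linear_intro [of _ "norm x"])
      (simp_all add: plus_antidual.rep_eq scaleR_antidual.rep_eq le)
  show "cnj (antidual_apply (c *\<^sub>C f) x) = cnj c * cnj (antidual_apply f x)" for c f
    by (simp add: scaleC_antidual.rep_eq)
qed

definition hilbert_adjoint ::
  "('h::complex_inner \<Rightarrow> 'f::complex_normed_vector) \<Rightarrow> 'f antidual \<Rightarrow> 'h" where
  "hilbert_adjoint S \<phi> = (THE h. \<forall>\<xi>. cinner h \<xi> = antidual_apply \<phi> (S \<xi>))"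

definition orth_compl :: "'h::complex_inner set \<Rightarrow> 'h set" where
  "orth_compl S = {h. \<forall>s\<in>S. cinner h s = 0}"

(* Meaningful for closed subspaces M of a Hilbert space. *)
definition orth_proj :: "'h::complex_inner set \<Rightarrow> 'h \<Rightarrow> 'h" where
  "orth_proj M h = (THE k. k \<in> M \<and> h - k \<in> orth_compl M)"

context
  fixes A B :: "'e::complex_normed_vector \<Rightarrow> 'e antidual"
    and iA :: "'e antidual \<Rightarrow> 'h::complex_hilbert"
    and iB :: "'e antidual \<Rightarrow> 'k::complex_hilbert"
begin

(* In the next three definitions (iA (A x), iB (B y)) is the pair (A x, B y) seen as an
   element of the product of the completions; such pairs are dense in it. *)
definition J_ext :: "'h \<times> 'k \<Rightarrow> 'e antidual" where
  "J_ext = (THE T. continuous_on UNIV T \<and> (\<forall>x y. T (iA (A x), iB (B y)) = A x + B y))"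

definition JA_ext :: "'h \<times> 'k \<Rightarrow> 'e antidual" where
  "JA_ext = (THE T. continuous_on UNIV T \<and> (\<forall>x y. T (iA (A x), iB (B y)) = A x))"

definition JB_ext :: "'h \<times> 'k \<Rightarrow> 'e antidual" where
  "JB_ext = (THE T. continuous_on UNIV T \<and> (\<forall>x y. T (iA (A x), iB (B y)) = B y))"

definition P_proj :: "'h \<times> 'k \<Rightarrow> 'h \<times> 'k" where
  "P_proj = orth_proj (orth_compl (range (hilbert_adjoint J_ext \<circ> canonical_embedding)))"

end

end

(* The extensions are given by the inner product: (J_A (h, k)) y = (h | A y) and likewise for B.
   So J_A^* j_E x = (A x, 0), J_B^* j_E x = (0, B x), and J^* j_E x = (A x, B x) spans a subspace R
   with P the projection onto its complement. As P annihilates (A x, B x), we have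
   P (0, B x) = - P (A x, 0), and as P (A x, 0) is orthogonal to (A z, B z), pairing it with (0, B z)
   is minus pairing it with (A z, 0); the two signs cancel and both operators agree.
   With u = (A x, 0), the quadratic form is (P u | u) = |P u|^2, the squared distance of u
   from R, which is the infimum in question. *)
theory Submission
  imports Defs
begin

section \<open>Complex inner product spaces\<close>

lemma scaleC_minus_one: "(- 1) *\<^sub>C x = - (x::'a::complex_normed_vector)"
  using scaleC_of_real [of "- 1" x] by simp

lemma cinner_add_right: "cinner x (y + z) = cinner x y + cinner x z"
  by (metis cinner_add_left cinner_commute complex_cnj_add)

lemma cinner_scaleC_right: "cinner x (c *\<^sub>C y) = cnj c * cinner x y"
  by (metis cinner_commute cinner_scaleC_left complex_cnj_mult)

lemma cinner_minus_left: "cinner (- x) y = - cinner x y"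
  using cinner_scaleC_left [of "- 1" x y] by (simp add: scaleC_minus_one)

lemma cinner_minus_right: "cinner x (- y) = - cinner x y"
  using cinner_scaleC_right [of x "- 1" y] by (simp add: scaleC_minus_one)

lemma cinner_diff_left: "cinner (x - y) z = cinner x z - cinner y z"
  using cinner_add_left [of x "- y" z] by (simp add: cinner_minus_left)

lemma cinner_diff_right: "cinner x (y - z) = cinner x y - cinner x z"
  using cinner_add_right [of x y "- z"] by (simp add: cinner_minus_right)

lemma cinner_zero_left [simp]: "cinner 0 x = 0"
  using cinner_diff_left [of 0 0 x] by simp

lemma cinner_zero_right [simp]: "cinner x 0 = 0"
  using cinner_diff_right [of x 0 0] by simp

lemma cinner_self_eq_0: "cinner x x = 0 \<longleftrightarrow> x = 0"
  by (simp add: cinner_self)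

lemma cinner_eqI:
  assumes "\<And>z. cinner x z = cinner y z"
  shows "x = y"
  using assms [of "x - y"] cinner_self_eq_0 [of "x - y"] by (simp add: cinner_diff_left)

lemma norm_add_orthogonal:
  assumes "cinner x y = 0"
  shows "(norm (x + y))\<^sup>2 = (norm x)\<^sup>2 + (norm y)\<^sup>2"
proof -
  have "cinner y x = 0"
    using assms cinner_commute [of y x] by simp
  with assms have "cinner (x + y) (x + y) = cinner x x + cinner y y"
    by (simp add: cinner_add_left cinner_add_right)
  then show ?thesis
    unfolding cinner_self by (metis of_real_add of_real_eq_iff)
qed

lemma parallelogram_law:
  "(norm (x + y))\<^sup>2 + (norm (x - y))\<^sup>2 = 2 * (norm x)\<^sup>2 + 2 * (norm (y::'a::complex_inner))\<^sup>2"
proof -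
  have "cinner (x + y) (x + y) + cinner (x - y) (x - y) = 2 * cinner x x + 2 * cinner y y"
    by (simp add: cinner_add_left cinner_add_right cinner_diff_left cinner_diff_right)
  then have "complex_of_real ((norm (x + y))\<^sup>2 + (norm (x - y))\<^sup>2) =
      complex_of_real (2 * (norm x)\<^sup>2 + 2 * (norm y)\<^sup>2)"
    by (simp add: cinner_self)
  then show ?thesis
    using of_real_eq_iff by blast
qed

text \<open>The subtracted term is the orthogonal projection of \<open>x\<close> onto the line
  through \<open>y\<close>, so Pythagoras applies. Nonnegativity of the left side yields
  Cauchy-Schwarz; in the projection theorem the same identity turns minimality of a distance into
  orthogonality.\<close>

lemma norm_minus_component:
  assumes "y \<noteq> (0::'a::complex_inner)"
  shows "(norm (x - (cinner x y / complex_of_real ((norm y)\<^sup>2)) *\<^sub>C y))\<^sup>2 =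
    (norm x)\<^sup>2 - (cmod (cinner x y))\<^sup>2 / (norm y)\<^sup>2"
proof -
  define t where "t = cinner x y / complex_of_real ((norm y)\<^sup>2)"
  have "cinner (x - t *\<^sub>C y) y = 0"
    using assms by (simp add: cinner_diff_left cinner_scaleC_left cinner_self t_def)
  then have "cinner (x - t *\<^sub>C y) (t *\<^sub>C y) = 0"
    by (simp add: cinner_scaleC_right)
  from norm_add_orthogonal [OF this]
  have "(norm x)\<^sup>2 = (norm (x - t *\<^sub>C y))\<^sup>2 + (norm (t *\<^sub>C y))\<^sup>2"
    by simp
  moreover have "(norm (t *\<^sub>C y))\<^sup>2 = (cmod (cinner x y))\<^sup>2 / (norm y)\<^sup>2"
    using assms
    by (simp add: norm_scaleC t_def norm_divide power_mult_distrib power_divide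
        field_simps power2_eq_square norm_mult)
  ultimately show ?thesis
    by (simp add: t_def)
qed

lemma cinner_Cauchy_Schwarz: "cmod (cinner x y) \<le> norm x * norm y"
proof (cases "y = 0")
  case False
  have "0 \<le> (norm x)\<^sup>2 - (cmod (cinner x y))\<^sup>2 / (norm y)\<^sup>2"
    using norm_minus_component [OF False, of x] by (metis zero_le_power2)
  then have "(cmod (cinner x y))\<^sup>2 \<le> (norm x * norm y)\<^sup>2"
    using False by (simp add: field_simps power_mult_distrib)
  then show ?thesis
    by (rule power2_le_imp_le) simp
qed simp

text \<open>Conjugate-linearity in the second slot is still linearity over the reals, so
  \<open>cinner\<close> counts as a real bilinear map. This is what supplies its continuity
  below.\<close>

lemma bounded_bilinear_cinner: "bounded_bilinear (cinner :: 'a::complex_inner \<Rightarrow> 'a \<Rightarrow> complex)"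
proof
  fix x y z :: 'a and r :: real
  show "cinner (r *\<^sub>R x) y = r *\<^sub>R cinner x y"
    using cinner_scaleC_left [of "complex_of_real r" x y]
    by (simp add: scaleC_of_real scaleR_conv_of_real)
  show "cinner x (r *\<^sub>R y) = r *\<^sub>R cinner x y"
    using cinner_scaleC_right [of x "complex_of_real r" y]
    by (simp add: scaleC_of_real scaleR_conv_of_real)
  show "\<exists>K. \<forall>a b :: 'a. norm (cinner a b) \<le> norm a * norm b * K"
    by (rule exI [of _ 1]) (simp add: cinner_Cauchy_Schwarz)
qed (simp_all add: cinner_add_left cinner_add_right)

section \<open>Bounded complex-linear maps\<close>

lemma continuous_on_scaleC: "continuous_on S (\<lambda>x::'a::complex_normed_vector. c *\<^sub>C x)"
proof -
  have "bounded_linear (\<lambda>x::'a. c *\<^sub>C x)"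
  proof (rule bounded_linear_intro [where K = "cmod c"])
    show "c *\<^sub>C r *\<^sub>R x = r *\<^sub>R c *\<^sub>C x" for r and x :: 'a
      by (simp add: scaleC_of_real [symmetric] scaleC_scaleC mult.commute)
  qed (simp_all add: scaleC_add_right norm_scaleC)
  then show ?thesis
    by (rule linear_continuous_on)
qed

lemma bounded_clinearI:
  assumes "\<And>x y. T (x + y) = T x + T y" and "\<And>c x. T (c *\<^sub>C x) = c *\<^sub>C T x"
    and "\<And>x. norm (T x) \<le> norm x * K"
  shows "bounded_clinear T"
proof -
  have "T (r *\<^sub>R x) = r *\<^sub>R T x" for r x
    using assms(2) [of "complex_of_real r" x] by (simp add: scaleC_of_real)
  then have "bounded_linear T"
    using assms(1,3) by (intro bounded_linear_intro)
  with assms(2) show ?thesis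
    by (simp add: bounded_clinear_def)
qed

lemma bounded_clinear_compose:
  "bounded_clinear S \<Longrightarrow> bounded_clinear T \<Longrightarrow> bounded_clinear (S \<circ> T)"
  unfolding bounded_clinear_def o_def by (simp add: bounded_linear_compose)

section \<open>Orthogonal projections\<close>

definition csubspace :: "'a::complex_normed_vector set \<Rightarrow> bool" where
  "csubspace M \<longleftrightarrow> 0 \<in> M \<and> (\<forall>x\<in>M. \<forall>y\<in>M. x + y \<in> M) \<and> (\<forall>c. \<forall>x\<in>M. c *\<^sub>C x \<in> M)"

lemma csubspace_0: "csubspace M \<Longrightarrow> 0 \<in> M"
  and csubspace_add: "csubspace M \<Longrightarrow> x \<in> M \<Longrightarrow> y \<in> M \<Longrightarrow> x + y \<in> M"
  and csubspace_scaleC: "csubspace M \<Longrightarrow> x \<in> M \<Longrightarrow> c *\<^sub>C x \<in> M"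
  by (simp_all add: csubspace_def)

lemma csubspace_diff: "csubspace M \<Longrightarrow> x \<in> M \<Longrightarrow> y \<in> M \<Longrightarrow> x - y \<in> M"
  using csubspace_add [of M x "- y"] csubspace_scaleC [of M y "- 1"]
  by (simp add: scaleC_minus_one)

lemma csubspace_range:
  assumes "bounded_clinear T"
  shows "csubspace (range T)"
proof -
  have T: "linear T" "\<And>c x. T (c *\<^sub>C x) = c *\<^sub>C T x"
    using assms by (simp_all add: bounded_clinear_def bounded_linear.linear)
  show ?thesis
    unfolding csubspace_def
    using linear_0 [OF T(1)] linear_add [OF T(1), symmetric] T(2) [symmetric]
    by (auto simp: image_iff)
qed

lemma csubspace_closure:
  assumes "csubspace M"
  shows "csubspace (closure M)"
  unfolding csubspace_def
proof (intro conjI ballI allI)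
  show "0 \<in> closure M"
    using assms csubspace_0 closure_subset by blast
next
  fix x y assume "x \<in> closure M" "y \<in> closure M"
  then obtain f g where "\<forall>n. f n \<in> M" "f \<longlonglongrightarrow> x" "\<forall>n. g n \<in> M" "g \<longlonglongrightarrow> y"
    by (auto simp: closure_sequential)
  then have "\<forall>n. f n + g n \<in> M" "(\<lambda>n. f n + g n) \<longlonglongrightarrow> x + y"
    using assms by (auto intro: csubspace_add tendsto_add)
  then show "x + y \<in> closure M"
    unfolding closure_sequential by (intro exI [of _ "\<lambda>n. f n + g n"] conjI)
next
  fix c x assume "x \<in> closure M"
  moreover have "(\<lambda>x. c *\<^sub>C x) ` closure M \<subseteq> closure M"
    using csubspace_scaleC [OF assms] closure_subset [of M]
    by (intro image_closure_subset continuous_on_scaleC) auto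
  ultimately show "c *\<^sub>C x \<in> closure M"
    by blast
qed

section \<open>Orthogonal complements\<close>

lemma csubspace_orth_compl: "csubspace (orth_compl S)"
  by (simp add: csubspace_def orth_compl_def cinner_add_left cinner_scaleC_left)

lemma closed_orth_compl: "closed (orth_compl S)"
proof -
  have "orth_compl S = (\<Inter>s\<in>S. {h. cinner h s = 0})"
    by (auto simp: orth_compl_def)
  moreover have "closed {h. cinner h s = 0}" for s :: 'a
    by (intro closed_Collect_eq bounded_bilinear.continuous_on [OF bounded_bilinear_cinner]
        continuous_intros)
  ultimately show ?thesis
    by (simp add: closed_INT)
qed

text \<open>The vectors orthogonal to a fixed \<open>h\<close> form a closed set, so passing to the
  closure imposes no new condition. This links a subspace that may fail to be closed with the closed
  one to which projection applies.\<close>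

lemma orth_compl_closure: "orth_compl (closure S) = orth_compl S"
proof
  show "orth_compl (closure S) \<subseteq> orth_compl S"
    using closure_subset [of S] by (auto simp: orth_compl_def)
  show "orth_compl S \<subseteq> orth_compl (closure S)"
  proof
    fix h assume "h \<in> orth_compl S"
    moreover have "closed {s. cinner h s = 0}"
      by (intro closed_Collect_eq bounded_bilinear.continuous_on [OF bounded_bilinear_cinner]
          continuous_intros)
    ultimately have "closure S \<subseteq> {s. cinner h s = 0}"
      by (intro closure_minimal) (auto simp: orth_compl_def)
    then show "h \<in> orth_compl (closure S)"
      by (auto simp: orth_compl_def)
  qed
qed

text \<open>A minimising sequence is Cauchy by the parallelogram law: midpoints stay in
  \<open>M\<close>, so they cannot be closer to \<open>h\<close> than the infimum. Its limit lies in
  \<open>M\<close> and attains the infimum.\<close>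

lemma nearest_point_exists:
  fixes h :: "'h::complex_hilbert"
  assumes M: "csubspace M" and "closed M"
  shows "\<exists>q\<in>M. \<forall>s\<in>M. norm (h - q) \<le> norm (h - s)"
proof -
  define d where "d = (INF s\<in>M. (norm (h - s))\<^sup>2)"
  have ne: "M \<noteq> {}"
    using csubspace_0 [OF M] by blast
  have bdd: "bdd_below ((\<lambda>s. (norm (h - s))\<^sup>2) ` M)"
    by (rule bdd_belowI [of _ 0]) auto
  have d_le: "d \<le> (norm (h - s))\<^sup>2" if "s \<in> M" for s
    unfolding d_def using bdd that by (rule cINF_lower)
  have "\<exists>s\<in>M. (norm (h - s))\<^sup>2 < d + 1 / real (Suc n)" for n
    using cINF_less_iff [OF ne bdd, of "d + 1 / real (Suc n)"] by (simp add: d_def)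
  then obtain f where f: "\<And>n. f n \<in> M" "\<And>n. (norm (h - f n))\<^sup>2 < d + 1 / real (Suc n)"
    by metis
  have diff: "(norm (f m - f n))\<^sup>2 \<le> 2 / real (Suc m) + 2 / real (Suc n)" for m n
  proof -
    \<comment> \<open>The midpoint of two near-minimisers competes in the infimum, which bounds the
      sum term of the parallelogram law below by \<open>4 * d\<close>.\<close>
    have "complex_of_real (1/2) *\<^sub>C (f m + f n) \<in> M"
      using M f(1) by (intro csubspace_scaleC csubspace_add)
    then have "d \<le> (norm (h - (1/2) *\<^sub>R (f m + f n)))\<^sup>2"
      using d_le by (simp only: scaleC_of_real)
    moreover have "(h - f m) + (h - f n) = 2 *\<^sub>R (h - (1/2) *\<^sub>R (f m + f n))"
      by (simp add: scaleR_diff_right scaleR_2)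
    then have "(norm ((h - f m) + (h - f n)))\<^sup>2 = 4 * (norm (h - (1/2) *\<^sub>R (f m + f n)))\<^sup>2"
      by (simp only: norm_scaleR power_mult_distrib) simp
    ultimately have "4 * d \<le> (norm ((h - f m) + (h - f n)))\<^sup>2"
      by simp
    moreover have "(norm ((h - f m) - (h - f n)))\<^sup>2 = (norm (f m - f n))\<^sup>2"
      by (simp add: norm_minus_commute)
    ultimately show ?thesis
      using parallelogram_law [of "h - f m" "h - f n"] f(2) [of m] f(2) [of n] by simp
  qed
  have "Cauchy f"
  proof (rule metric_CauchyI)
    fix e :: real assume "0 < e"
    \<comment> \<open>For indices from \<open>N\<close> on, \<open>diff\<close> bounds the squared
      distance by 4 / (N + 1), which has to fall below the square of \<open>e\<close>.\<close>
    then obtain N where N: "1 / real (Suc N) < e\<^sup>2 / 4"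
      using nat_approx_posE [of "e\<^sup>2 / 4"] by auto
    have "dist (f m) (f n) < e" if "N \<le> m" "N \<le> n" for m n
    proof -
      have "1 / real (Suc m) \<le> 1 / real (Suc N)" "1 / real (Suc n) \<le> 1 / real (Suc N)"
        using that by (simp_all add: frac_le)
      then have "(norm (f m - f n))\<^sup>2 < e\<^sup>2"
        using diff [of m n] N by simp
      then show ?thesis
        using \<open>0 < e\<close> by (simp add: dist_norm power2_less_imp_less)
    qed
    then show "\<exists>N. \<forall>m\<ge>N. \<forall>n\<ge>N. dist (f m) (f n) < e"
      by blast
  qed
  then obtain q where q: "f \<longlonglongrightarrow> q"
    using Cauchy_convergent_iff convergent_def by blast
  have "q \<in> M"
    using \<open>closed M\<close> f(1) q by (metis closed_sequentially)
  moreover have "(norm (h - q))\<^sup>2 \<le> d"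
  proof (rule LIMSEQ_le)
    show "(\<lambda>n. (norm (h - f n))\<^sup>2) \<longlonglongrightarrow> (norm (h - q))\<^sup>2"
      by (intro tendsto_intros q)
    show "(\<lambda>n. d + 1 / real (Suc n)) \<longlonglongrightarrow> d"
      using tendsto_add [OF tendsto_const LIMSEQ_Suc [OF lim_1_over_n], of d] by simp
    show "\<exists>N. \<forall>n\<ge>N. (norm (h - f n))\<^sup>2 \<le> d + 1 / real (Suc n)"
      using f(2) less_imp_le by blast
  qed
  then have "norm (h - q) \<le> norm (h - s)" if "s \<in> M" for s
    using d_le [OF that] by (meson norm_ge_zero order_trans power2_le_imp_le)
  ultimately show ?thesis
    by blast
qed

text \<open>The nearest point works: if \<open>h - q\<close> had a component along some
  \<open>s\<close> in \<open>M\<close>, moving \<open>q\<close> by that component would bring it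
  closer to \<open>h\<close>.\<close>

lemma orthogonal_decomposition_exists:
  fixes h :: "'h::complex_hilbert"
  assumes M: "csubspace M" and "closed M"
  shows "\<exists>k\<in>M. h - k \<in> orth_compl M"
proof -
  obtain q where q: "q \<in> M" "\<And>s. s \<in> M \<Longrightarrow> norm (h - q) \<le> norm (h - s)"
    using nearest_point_exists [OF assms] by blast
  have "cinner (h - q) s = 0" if s: "s \<in> M" for s
  proof (cases "s = 0")
    case False
    \<comment> \<open>This \<open>t\<close> is the coefficient of the projection of
      \<open>h - q\<close> onto the line through \<open>s\<close>, the shift that gains
      most.\<close>
    define t where "t = cinner (h - q) s / complex_of_real ((norm s)\<^sup>2)"
    have "norm (h - q) \<le> norm (h - (q + t *\<^sub>C s))"
      using q M s by (intro q(2) csubspace_add csubspace_scaleC)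
    then have "(norm (h - q))\<^sup>2 \<le> (norm (h - q - t *\<^sub>C s))\<^sup>2"
      by (intro power_mono) (simp_all add: diff_diff_add)
    then have "(cmod (cinner (h - q) s))\<^sup>2 / (norm s)\<^sup>2 \<le> 0"
      using norm_minus_component [OF False, of "h - q", folded t_def] by linarith
    then show ?thesis
      using False by (simp add: divide_le_0_iff)
  qed simp
  with q(1) show ?thesis
    by (auto simp: orth_compl_def)
qed

lemma orth_compl_Int: "h \<in> M \<Longrightarrow> h \<in> orth_compl M \<Longrightarrow> h = 0"
  by (auto simp: orth_compl_def cinner_self_eq_0)

text \<open>Two candidates differ by a vector that lies both in \<open>M\<close> and in its
  complement, hence by zero. Projections can thus be computed by naming a value and checking the two
  conditions.\<close>

lemma orth_proj_eq:
  assumes M: "csubspace M" and k: "k \<in> M" "h - k \<in> orth_compl M"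
  shows "orth_proj M h = k"
  unfolding orth_proj_def
proof (rule the_equality)
  fix l assume l: "l \<in> M \<and> h - l \<in> orth_compl M"
  have "(h - k) - (h - l) \<in> orth_compl M"
    using csubspace_diff [OF csubspace_orth_compl k(2)] l by blast
  then have "l - k \<in> orth_compl M"
    by simp
  moreover have "l - k \<in> M"
    using k l M by (auto intro: csubspace_diff)
  ultimately show "l = k"
    using orth_compl_Int [of "l - k" M] by simp
qed (use k in simp)

context
  fixes M :: "'h::complex_hilbert set"
  assumes M: "csubspace M" "closed M"
begin

lemma orth_proj_in: "orth_proj M h \<in> M"
  and diff_orth_proj_in: "h - orth_proj M h \<in> orth_compl M"
  using orthogonal_decomposition_exists [OF M, of h] orth_proj_eq [OF M(1)] by metis+

lemma cinner_diff_orth_proj: "s \<in> M \<Longrightarrow> cinner (h - orth_proj M h) s = 0"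
  using diff_orth_proj_in by (auto simp: orth_compl_def)

text \<open>Split \<open>h\<close> into its projection and a remainder orthogonal to it. In the
  theorem this makes the quadratic form a squared norm, which gives positivity and the link with
  distances.\<close>

lemma cinner_orth_proj_self: "cinner (orth_proj M h) h = complex_of_real ((norm (orth_proj M h))\<^sup>2)"
  using cinner_diff_orth_proj [OF orth_proj_in, of h h]
    cinner_commute [of "orth_proj M h" h]
  by (simp add: cinner_diff_left cinner_self)

text \<open>Linearity comes from uniqueness: sums and multiples of projections satisfy the defining
  conditions. Pythagoras gives the norm bound.\<close>

lemma bounded_clinear_orth_proj: "bounded_clinear (orth_proj M)"
proof (rule bounded_clinearI [where K = 1])
  show "orth_proj M (x + y) = orth_proj M x + orth_proj M y" for x y
  proof (rule orth_proj_eq [OF M(1)])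
    show "orth_proj M x + orth_proj M y \<in> M"
      by (intro csubspace_add M orth_proj_in)
    have "(x - orth_proj M x) + (y - orth_proj M y) \<in> orth_compl M"
      by (intro csubspace_add csubspace_orth_compl diff_orth_proj_in)
    then show "x + y - (orth_proj M x + orth_proj M y) \<in> orth_compl M"
      by (simp add: algebra_simps)
  qed
  show "orth_proj M (c *\<^sub>C x) = c *\<^sub>C orth_proj M x" for c x
  proof (rule orth_proj_eq [OF M(1)])
    show "c *\<^sub>C orth_proj M x \<in> M"
      by (intro csubspace_scaleC M orth_proj_in)
    show "c *\<^sub>C x - c *\<^sub>C orth_proj M x \<in> orth_compl M"
      using diff_orth_proj_in [of x]
      by (simp add: orth_compl_def cinner_diff_left cinner_scaleC_left)
  qed
  show "norm (orth_proj M x) \<le> norm x * 1" for x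
  proof -
    have "(norm x)\<^sup>2 = (norm (x - orth_proj M x))\<^sup>2 + (norm (orth_proj M x))\<^sup>2"
      using norm_add_orthogonal [OF cinner_diff_orth_proj [OF orth_proj_in, of x x]] by simp
    then have "(norm (orth_proj M x))\<^sup>2 \<le> (norm x)\<^sup>2"
      by simp
    from power2_le_imp_le [OF this] show ?thesis
      by simp
  qed
qed

end

text \<open>For \<open>h\<close> in the double complement, the remainder after projecting to
  \<open>closure R\<close> is orthogonal to \<open>h\<close> and to the projection, hence to itself,
  and vanishes. Conversely, the double complement is closed and contains \<open>R\<close>.\<close>

lemma orth_compl_orth_compl:
  fixes R :: "'h::complex_hilbert set"
  assumes "csubspace R"
  shows "orth_compl (orth_compl R) = closure R"
proof
  note R = csubspace_closure [OF assms] closed_closure [of R]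
  show "orth_compl (orth_compl R) \<subseteq> closure R"
  proof
    fix h assume h: "h \<in> orth_compl (orth_compl R)"
    let ?q = "orth_proj (closure R) h"
    have *: "h - ?q \<in> orth_compl R"
      using diff_orth_proj_in [OF R] by (simp add: orth_compl_closure)
    then have "cinner h (h - ?q) = 0" "cinner (h - ?q) ?q = 0"
      using h cinner_diff_orth_proj [OF R orth_proj_in [OF R]] by (simp_all add: orth_compl_def)
    then have "cinner (h - ?q) (h - ?q) = 0"
      using cinner_commute [of ?q "h - ?q"] by (simp add: cinner_diff_left)
    then have "h = ?q"
      by (simp add: cinner_self_eq_0)
    then show "h \<in> closure R"
      using orth_proj_in [OF R] by metis
  qed
  show "closure R \<subseteq> orth_compl (orth_compl R)"
  proof (rule closure_minimal)
    show "R \<subseteq> orth_compl (orth_compl R)"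
    proof
      fix r assume "r \<in> R"
      then have "cinner r s = 0" if "s \<in> orth_compl R" for s
        using that cinner_commute [of r s] by (simp add: orth_compl_def)
      then show "r \<in> orth_compl (orth_compl R)"
        by (simp add: orth_compl_def)
    qed
  qed (rule closed_orth_compl)
qed

text \<open>With \<open>?p\<close> the projection, \<open>h - ?p\<close> lies in
  \<open>closure R\<close>. For \<open>s\<close> in \<open>R\<close>, the vector
  \<open>h - s\<close> is the orthogonal sum of \<open>?p\<close> and \<open>(h - ?p) - s\<close>,
  so its norm is at least that of \<open>?p\<close>.\<close>

lemma norm_orth_proj_orth_compl:
  fixes R :: "'h::complex_hilbert set"
  assumes R: "csubspace R"
  shows "(norm (orth_proj (orth_compl R) h))\<^sup>2 = (INF s\<in>R. (norm (h - s))\<^sup>2)"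
proof (rule antisym)
  note M = csubspace_orth_compl [of R] closed_orth_compl [of R]
  let ?p = "orth_proj (orth_compl R) h"
  have q: "h - ?p \<in> closure R"
    using diff_orth_proj_in [OF M] orth_compl_orth_compl [OF R] by blast
  show "(norm ?p)\<^sup>2 \<le> (INF s\<in>R. (norm (h - s))\<^sup>2)"
  proof (rule cINF_greatest)
    show "R \<noteq> {}"
      using csubspace_0 [OF R] by blast
    fix s assume "s \<in> R"
    then have "(h - ?p) - s \<in> closure R"
      using csubspace_diff [OF csubspace_closure [OF R] q] closure_subset by blast
    then have "cinner ?p ((h - ?p) - s) = 0"
      using orth_proj_in [OF M, of h] orth_compl_closure [of R] by (auto simp: orth_compl_def)
    from norm_add_orthogonal [OF this]
    have "(norm (h - s))\<^sup>2 = (norm ?p)\<^sup>2 + (norm ((h - ?p) - s))\<^sup>2"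
      by simp
    then show "(norm ?p)\<^sup>2 \<le> (norm (h - s))\<^sup>2"
      by simp
  qed
  \<comment> \<open>The infimum may not be attained on \<open>R\<close>. Its defining bound extends
    to the closure by continuity and is then read off at \<open>h - ?p\<close>, whose difference
    from \<open>h\<close> is \<open>?p\<close>.\<close>
  have "closure R \<subseteq> {s. (INF s\<in>R. (norm (h - s))\<^sup>2) \<le> (norm (h - s))\<^sup>2}"
  proof (rule closure_minimal)
    have "bdd_below ((\<lambda>s. (norm (h - s))\<^sup>2) ` R)"
      by (rule bdd_belowI [of _ 0]) auto
    then show "R \<subseteq> {s. (INF s\<in>R. (norm (h - s))\<^sup>2) \<le> (norm (h - s))\<^sup>2}"
      by (auto intro: cINF_lower)
  qed (intro closed_Collect_le continuous_intros)
  with q show "(INF s\<in>R. (norm (h - s))\<^sup>2) \<le> (norm ?p)\<^sup>2"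
    by auto
qed

section \<open>Completions and their embeddings into the antidual\<close>

lemma antidual_apply_le: "cmod (antidual_apply f x) \<le> norm f * norm x"
  using onorm [OF antidual_bounded_linear [of f], of x] by (simp add: norm_antidual.rep_eq)

lemma norm_antidual_le:
  assumes "0 \<le> b" and "\<And>x. cmod (antidual_apply f x) \<le> b * norm x"
  shows "norm f \<le> b"
  using assms by (simp add: norm_antidual.rep_eq onorm_bound)

(* For the map v x = A x into the completion, riesz_embedding v is the inclusion of H_A into the
   antidual. *)
definition riesz_embedding ::
  "('e::complex_normed_vector \<Rightarrow> 'h::complex_inner) \<Rightarrow> 'h \<Rightarrow> 'e antidual" where
  "riesz_embedding v h = Antidual (\<lambda>x. cinner h (v x))"

lemma riesz_embedding_apply:
  assumes "bounded_clinear v"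
  shows "antidual_apply (riesz_embedding v h) x = cinner h (v x)"
proof -
  have "bounded_linear (\<lambda>x. cinner h (v x))"
    using assms bounded_linear_compose
      [OF bounded_bilinear.bounded_linear_right [OF bounded_bilinear_cinner], of v h]
    by (simp add: bounded_clinear_def)
  moreover have "cinner h (v (c *\<^sub>C x)) = cnj c * cinner h (v x)" for c x
    using assms by (simp add: bounded_clinear_def cinner_scaleC_right)
  ultimately show ?thesis
    by (simp add: riesz_embedding_def Antidual_inverse)
qed

lemma bounded_clinear_riesz_embedding:
  assumes "bounded_clinear v"
  shows "bounded_clinear (riesz_embedding v)"
proof -
  from assms obtain K where K: "0 \<le> K" "\<And>x. norm (v x) \<le> norm x * K"
    using bounded_linear.nonneg_bounded unfolding bounded_clinear_def by metis
  show ?thesis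
  proof (rule bounded_clinearI [where K = K])
    show "norm (riesz_embedding v h) \<le> norm h * K" for h
    proof (rule norm_antidual_le)
      fix x
      have "cmod (cinner h (v x)) \<le> norm h * norm (v x)"
        by (rule cinner_Cauchy_Schwarz)
      also have "\<dots> \<le> norm h * (norm x * K)"
        by (intro mult_left_mono K) simp
      finally show "cmod (antidual_apply (riesz_embedding v h) x) \<le> norm h * K * norm x"
        by (simp add: riesz_embedding_apply [OF assms] mult_ac)
    qed (simp add: K)
  qed (auto intro!: antidual_eqI simp: riesz_embedding_apply [OF assms] plus_antidual.rep_eq
      scaleC_antidual.rep_eq cinner_add_left cinner_scaleC_left)
qed

text \<open>The squared norm of \<open>i (A x)\<close> is the value of \<open>A x\<close> at
  \<open>x\<close>, which is at most \<open>K\<close> times the squared norm of \<open>x\<close>.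
  This is why the bound is the square root of the operator bound.\<close>

lemma hilbert_completion_bounded_clinear:
  assumes A: "positive_operator A" and i: "hilbert_completion A i"
  shows "bounded_clinear (i \<circ> A)"
proof -
  have A': "bounded_linear A" "\<And>c x. A (c *\<^sub>C x) = c *\<^sub>C A x"
    using A by (auto simp: positive_operator_def bounded_clinear_def)
  then obtain K where K: "0 \<le> K" "\<And>x. norm (A x) \<le> norm x * K"
    using bounded_linear.nonneg_bounded by metis
  show ?thesis
  proof (rule bounded_clinearI [where K = "sqrt K"])
    show "(i \<circ> A) (x + y) = (i \<circ> A) x + (i \<circ> A) y" for x y
      using i by (simp add: hilbert_completion_def linear_add [OF bounded_linear.linear [OF A'(1)]])
    show "(i \<circ> A) (c *\<^sub>C x) = c *\<^sub>C (i \<circ> A) x" for c x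
      using i by (simp add: hilbert_completion_def A'(2))
    show "norm ((i \<circ> A) x) \<le> norm x * sqrt K" for x
    proof (rule power2_le_imp_le)
      have "(norm (i (A x)))\<^sup>2 = cmod (cinner (i (A x)) (i (A x)))"
        by (simp add: cinner_self norm_power)
      also have "\<dots> = cmod (antidual_apply (A x) x)"
        using i by (simp add: hilbert_completion_def)
      also have "\<dots> \<le> norm (A x) * norm x"
        by (rule antidual_apply_le)
      also have "\<dots> \<le> norm x * K * norm x"
        by (intro mult_right_mono K) simp
      finally show "(norm ((i \<circ> A) x))\<^sup>2 \<le> (norm x * sqrt K)\<^sup>2"
        using K(1) by (simp add: power_mult_distrib power2_eq_square [of "norm x"] mult_ac)
    qed (simp add: K(1))
  qed
qed

text \<open>A representing vector is unique because \<open>cinner\<close> is nondegenerate, so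
  exhibiting one identifies the value of the adjoint.\<close>

lemma hilbert_adjoint_eqI:
  assumes "\<And>\<xi>. cinner h \<xi> = antidual_apply \<phi> (S \<xi>)"
  shows "hilbert_adjoint S \<phi> = h"
  unfolding hilbert_adjoint_def using assms by (intro the_equality cinner_eqI) auto

text \<open>The pairs \<open>(v x, w y)\<close> are dense in the product, and continuous maps that
  agree on a dense set coincide. An explicit bounded operator with the right values on these pairs
  is therefore the extension described by \<open>THE\<close>.\<close>

lemma continuous_extension_eqI:
  fixes S :: "'h::complex_hilbert \<times> 'k::complex_hilbert \<Rightarrow> 'f::complex_normed_vector"
  assumes "closure (range v) = UNIV" "closure (range w) = UNIV" and "bounded_clinear S"
    and "\<And>x y. S (v x, w y) = G x y"
  shows "(THE T. continuous_on UNIV T \<and> (\<forall>x y. T (v x, w y) = G x y)) = S"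
proof (rule the_equality)
  have S: "continuous_on UNIV S"
    using assms(3) by (simp add: bounded_clinear_def linear_continuous_on)
  then show "continuous_on UNIV S \<and> (\<forall>x y. S (v x, w y) = G x y)"
    using assms(4) by simp
  fix T assume T: "continuous_on UNIV T \<and> (\<forall>x y. T (v x, w y) = G x y)"
  have "closure (range v \<times> range w) \<subseteq> {z. T z = S z}"
    using T S assms(4) by (intro closure_minimal closed_Collect_eq) auto
  then show "T = S"
    using assms(1,2) by (auto simp: closure_Times)
qed

theorem theorem4p1:
  fixes A B :: "'e::complex_banach \<Rightarrow> 'e antidual"
    and iA :: "'e antidual \<Rightarrow> 'h::complex_hilbert"
    and iB :: "'e antidual \<Rightarrow> 'k::complex_hilbert"
  assumes "positive_operator A" and "positive_operator B"
    and "hilbert_completion A iA" and "hilbert_completion B iB"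
  shows "let JA = JA_ext A B iA iB; JB = JB_ext A B iA iB; P = P_proj A B iA iB;
             S = JA \<circ> P \<circ> hilbert_adjoint JA \<circ> canonical_embedding;
             T = JB \<circ> P \<circ> hilbert_adjoint JB \<circ> canonical_embedding
         in positive_operator S \<and> positive_operator T \<and> S = T \<and>
            (\<forall>x. antidual_apply (S x) x =
               complex_of_real (INF y. Re (antidual_apply (A (x - y)) (x - y) + antidual_apply (B y) y)))"
proof -
  \<comment> \<open>Working with \<open>v\<close> and \<open>w\<close> keeps every use of
    \<open>iA\<close> and \<open>iB\<close> on the ranges of \<open>A\<close> and \<open>B\<close>,
    where their values are prescribed.\<close>
  define v where "v = iA \<circ> A"
  define w where "w = iB \<circ> B"
  have v: "bounded_clinear v" and w: "bounded_clinear w"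
    using assms by (simp_all add: v_def w_def hilbert_completion_bounded_clinear)
  have dense: "closure (range v) = UNIV" "closure (range w) = UNIV"
    using assms(3,4) by (simp_all add: hilbert_completion_def v_def w_def image_comp)
  have cinner_v: "cinner (v x) (v y) = antidual_apply (A x) y"
    and cinner_w: "cinner (w x) (w y) = antidual_apply (B x) y" for x y
    using assms(3,4) by (simp_all add: hilbert_completion_def v_def w_def)
  have v_diff: "v (x - y) = v x - v y" for x y
    using v by (simp add: bounded_clinear_def bounded_linear.linear linear_diff)
  note apply_v = riesz_embedding_apply [OF v] and apply_w = riesz_embedding_apply [OF w]
  have fst: "bounded_clinear (fst :: 'h \<times> 'k \<Rightarrow> 'h)" and snd: "bounded_clinear (snd :: 'h \<times> 'k \<Rightarrow> 'k)"
    by (simp_all add: bounded_clinear_def bounded_linear_fst bounded_linear_snd scaleC_prod_def)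

  \<comment> \<open>Explicit candidates for the extensions: project to one coordinate, then include
    that completion into the antidual.\<close>
  define JA :: "'h \<times> 'k \<Rightarrow> 'e antidual" where "JA = riesz_embedding v \<circ> fst"
  define JB :: "'h \<times> 'k \<Rightarrow> 'e antidual" where "JB = riesz_embedding w \<circ> snd"
  have JA: "bounded_clinear JA" and JB: "bounded_clinear JB"
    unfolding JA_def JB_def
    by (intro bounded_clinear_compose bounded_clinear_riesz_embedding fst snd v w)+
  have JAB: "bounded_clinear (\<lambda>z. JA z + JB z)"
    using JA JB by (auto simp: bounded_clinear_def bounded_linear_add scaleC_add_right)
  have JA_apply: "antidual_apply (JA z) x = cinner z (v x, 0)"
    and JB_apply: "antidual_apply (JB z) x = cinner z (0, w x)" for z x
    by (simp_all add: JA_def JB_def apply_v apply_w cinner_prod_def)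
  have JA_pair: "JA (v x, w y) = A x" and JB_pair: "JB (v x, w y) = B y" for x y
    by (auto intro!: antidual_eqI
        simp: JA_apply JB_apply cinner_prod_def cinner_v cinner_w)
  have J_ext: "J_ext A B iA iB = (\<lambda>z. JA z + JB z)"
    unfolding J_ext_def
    using continuous_extension_eqI [OF dense JAB, of "\<lambda>x y. A x + B y"] JA_pair JB_pair
    by (simp add: v_def w_def)
  have JA_ext: "JA_ext A B iA iB = JA"
    unfolding JA_ext_def
    using continuous_extension_eqI [OF dense JA, of "\<lambda>x y. A x"] JA_pair
    by (simp add: v_def w_def)
  have JB_ext: "JB_ext A B iA iB = JB"
    unfolding JB_ext_def
    using continuous_extension_eqI [OF dense JB, of "\<lambda>x y. B y"] JB_pair
    by (simp add: v_def w_def)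

  \<comment> \<open>The conjugate in the canonical embedding cancels the one produced by exchanging
    the arguments of \<open>cinner\<close>.\<close>
  have adj_JA: "hilbert_adjoint JA (canonical_embedding x) = (v x, 0)"
    and adj_JB: "hilbert_adjoint JB (canonical_embedding x) = (0, w x)" for x
    by (intro hilbert_adjoint_eqI,
        simp add: canonical_embedding.rep_eq JA_apply JB_apply cinner_commute [symmetric])+
  have adj_J: "hilbert_adjoint (\<lambda>z. JA z + JB z) (canonical_embedding x) = (v x, w x)" for x
  proof (rule hilbert_adjoint_eqI)
    fix \<xi> :: "'h \<times> 'k"
    show "cinner (v x, w x) \<xi> = antidual_apply (canonical_embedding x) (JA \<xi> + JB \<xi>)"
      using cinner_commute [of "v x" "fst \<xi>"] cinner_commute [of "w x" "snd \<xi>"]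
      by (simp add: canonical_embedding.rep_eq plus_antidual.rep_eq JA_apply JB_apply
          cinner_prod_def)
  qed

  \<comment> \<open>By \<open>adj_J\<close>, \<open>r x\<close> is the adjoint of the extended
    \<open>J\<close> at the embedded \<open>x\<close>, so \<open>range r\<close> is the subspace
    whose complement is the target of \<open>P\<close>.\<close>
  define r where "r x = (v x, w x)" for x
  have r: "bounded_clinear r"
    using v w by (auto simp: r_def [abs_def] bounded_clinear_def scaleC_prod_def bounded_linear_Pair)
  then have R: "csubspace (range r)"
    by (rule csubspace_range)
  define M where "M = orth_compl (range r)"
  have M: "csubspace M" "closed M"
    by (simp_all add: M_def csubspace_orth_compl closed_orth_compl)
  define P where "P = orth_proj M"
  have P: "P_proj A B iA iB = P"
    by (simp add: P_proj_def P_def M_def J_ext o_def adj_J r_def [abs_def])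
  have P_orth: "cinner (P h) (r x) = 0" for h x
    using orth_proj_in [OF M, of h] by (simp add: P_def M_def orth_compl_def)
  have P_lin: "bounded_clinear P"
    unfolding P_def by (rule bounded_clinear_orth_proj [OF M])
  have P_r: "P (r x) = 0" for x
  proof -
    \<comment> \<open>The complement of \<open>M\<close> is the closure of \<open>range r\<close>,
      so \<open>r x\<close> has no component in \<open>M\<close>.\<close>
    have "orth_proj M (r x) = 0"
    proof (rule orth_proj_eq [OF M(1) csubspace_0 [OF M(1)]])
      show "r x - 0 \<in> orth_compl M"
        unfolding M_def orth_compl_orth_compl [OF R] using closure_subset by fastforce
    qed
    then show ?thesis
      by (simp add: P_def)
  qed

  \<comment> \<open>The two operators and their quadratic form\<close>
  define S where "S = JA \<circ> P \<circ> hilbert_adjoint JA \<circ> canonical_embedding"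
  define T where "T = JB \<circ> P \<circ> hilbert_adjoint JB \<circ> canonical_embedding"
  have S: "S x = JA (P (v x, 0))" and T: "T x = JB (P (0, w x))" for x
    by (simp_all add: S_def T_def adj_JA adj_JB)
  have "S = T"
  proof (intro ext antidual_eqI)
    fix x z
    \<comment> \<open>One identity is substituted inside \<open>P\<close>, where \<open>P_r\<close>
      removes \<open>r x\<close>; the other in the second slot of the pairing, where
      \<open>P_orth\<close> removes \<open>r z\<close>.\<close>
    have "(0, w x) = r x - (v x, 0)" "(0, w z) = r z - (v z, 0)"
      by (simp_all add: r_def)
    moreover have "P (r x - (v x, 0)) = P (r x) - P (v x, 0)"
      using P_lin by (simp add: bounded_clinear_def bounded_linear.linear linear_diff)
    ultimately show "antidual_apply (S x) z = antidual_apply (T x) z"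
      by (simp add: S T JA_apply JB_apply P_r P_orth cinner_minus_left cinner_diff_right)
  qed
  have S_norm: "antidual_apply (S x) x = complex_of_real ((norm (P (v x, 0)))\<^sup>2)" for x
    unfolding S JA_apply P_def by (rule cinner_orth_proj_self [OF M])
  have S_inf: "antidual_apply (S x) x = complex_of_real
    (INF y. Re (antidual_apply (A (x - y)) (x - y) + antidual_apply (B y) y))" for x
  proof -
    \<comment> \<open>The difference is the pair of \<open>v (x - y)\<close> and
      \<open>- w y\<close>; the sign disappears in the norm, and each coordinate contributes one of
      the two forms.\<close>
    have "(norm ((v x, 0) - r y))\<^sup>2 =
        Re (antidual_apply (A (x - y)) (x - y) + antidual_apply (B y) y)" for y
      by (simp add: r_def norm_prod_def cinner_v [symmetric] cinner_w [symmetric] cinner_self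
          v_diff)
    then show ?thesis
      unfolding S_norm P_def M_def norm_orth_proj_orth_compl [OF R] by (simp add: image_comp o_def)
  qed
  \<comment> \<open>Positivity is verified for \<open>S\<close> and passes to \<open>T\<close>
    through their equality.\<close>
  have "bounded_clinear (\<lambda>x. (v x, 0 :: 'k))"
    using v by (auto simp: bounded_clinear_def scaleC_prod_def bounded_linear_Pair
        norm_scaleC norm_eq_zero [symmetric] simp del: norm_eq_zero)
  then have "bounded_clinear (JA \<circ> P \<circ> (\<lambda>x. (v x, 0)))"
    by (intro bounded_clinear_compose JA P_lin)
  moreover have "S = JA \<circ> P \<circ> (\<lambda>x. (v x, 0))"
    by (simp add: fun_eq_iff S)
  moreover have "antidual_apply (S x) x \<in> \<real>\<^sub>\<ge>\<^sub>0" for x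
    unfolding S_norm by simp
  ultimately have "positive_operator S"
    by (simp add: positive_operator_def)
  with \<open>S = T\<close> S_inf show ?thesis
    unfolding Let_def JA_ext JB_ext P S_def [symmetric] T_def [symmetric] by blast
qed

end
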